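(* Let $n\ge1$ and let $p\ge2$ be an integer. There exists a constant $N$, depending only on $p$ and $n$, such that every open set in $\mathbb{R}^n$ can be covered by $N$ open $2^{2p+2}\sqrt n$-admissible Whitney sets.
   Context: Put $m(x)=\min\{1,1/|x|\}$ for $x\in\mathbb{R}^n$ (with $m(0)=1$), where $|\cdot|$ is the Euclidean norm. For $\lambda>0$, a set $A\subseteq\mathbb{R}^n$ is called a $\lambda$-admissible Whitney set if for all $x\in A$ one has $d(x,\complement A)\le\lambda m(x)$, where $\complement A=\mathbb{R}^n\setminus A$ and $d$ is the Euclidean distance. *)

theory Defs
  imports "HOL-Analysis.Analysis"
begin

text \<open>The value at \<open>0\<close> is set separately, since \<open>1 / 0 = 0\<close> in HOL.\<close>

definition whitney_weight :: "real ^ 'n \<Rightarrow> real"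
  where "whitney_weight x = (if x = 0 then 1 else min 1 (1 / norm x))"

text \<open>
  The distance to a set is taken in the extended reals, so that the distance to the empty
  set is \<open>\<infinity>\<close>. The library functions \<open>infdist\<close> and \<open>setdist\<close> give \<open>0\<close> there, which would make
  the whole space an admissible Whitney set.
\<close>

definition edist_set :: "real ^ 'n \<Rightarrow> (real ^ 'n) set \<Rightarrow> ereal"
  where "edist_set x S = (INF y\<in>S. ereal (dist x y))"

definition admissible_whitney :: "real \<Rightarrow> (real ^ 'n) set \<Rightarrow> bool"
  where "admissible_whitney l A \<longleftrightarrow>
    (\<forall>x\<in>A. edist_set x (- A) \<le> ereal (l * whitney_weight x))"

end

theory Submission
  imports Defs
begin

text \<open>
  Admissibility passes to subsets: shrinking a set enlarges its complement, which can only
  decrease distances to it. Hence it suffices to cover the whole space by \<open>N\<close> open admissible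
  sets and to intersect these with the given open set; and two sets are enough.

  Admissibility of an open \<open>W\<close> means that the closed set \<open>S = - W\<close> is \<open>\<lambda> m(x)\<close>-dense near
  every \<open>x\<close>, so two disjoint closed sets with this property are needed. Families of concentric
  spheres have it: if the squared radii form the progression \<open>\<int> - c\<close>, consecutive radii
  \<open>r < r'\<close> satisfy \<open>r' - r = 1 / (r' + r)\<close>, so that near a point \<open>x\<close> the gap between spheres is
  about \<open>1 / (2 |x|)\<close>, which is the decay prescribed by \<open>m\<close>. The shifts \<open>c = 0\<close> and \<open>c = 1/2\<close>
  give disjoint families of spheres. The constant of admissibility obtained is \<open>1\<close>, and
  \<open>N = 2\<close> serves for all \<open>p\<close> and \<open>n\<close>.
\<close>

lemma admissible_whitney_subset:
  assumes "admissible_whitney l B" and "A \<subseteq> B"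
  shows "admissible_whitney l A"
proof -
  have "edist_set x (- A) \<le> edist_set x (- B)" for x
    unfolding edist_set_def using \<open>A \<subseteq> B\<close> by (intro INF_superset_mono) auto
  then show ?thesis
    using assms unfolding admissible_whitney_def by (meson order_trans subsetD)
qed

lemma admissible_whitneyI:
  assumes "\<And>x. x \<in> A \<Longrightarrow> \<exists>y. y \<notin> A \<and> dist x y \<le> l * whitney_weight x"
  shows "admissible_whitney l A"
  unfolding admissible_whitney_def edist_set_def
  using assms by (meson ComplI INF_lower2 ereal_less_eq(3))

text \<open>
  Moving \<open>x\<close> radially outwards until its squared norm has grown by \<open>s\<close> displaces it by
  \<open>d = |y| - |x|\<close>. Since \<open>s = d (|y| + |x|)\<close> dominates both \<open>d\<^sup>2\<close> and \<open>d |x|\<close>, an increase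
  \<open>s \<le> 1\<close> costs no more than the weight at \<open>x\<close>.
\<close>

lemma exists_norm_square_near:
  fixes x :: "real ^ 'n"
  assumes "(norm x)\<^sup>2 \<le> t" and "t \<le> (norm x)\<^sup>2 + 1"
  shows "\<exists>y. (norm y)\<^sup>2 = t \<and> dist x y \<le> whitney_weight x"
proof -
  \<comment> \<open>A unit vector pointing towards \<open>x\<close>; at the origin every direction will do.\<close>
  obtain u :: "real ^ 'n" where u: "norm u = 1" "x = norm x *\<^sub>R u"
  proof (cases "x = 0")
    case True
    obtain e :: "real ^ 'n" where "norm e = 1"
      using vector_choose_size[of 1] by auto
    with True show ?thesis by (intro that[of e]) auto
  next
    case False
    then show ?thesis by (intro that[of "x /\<^sub>R norm x"]) auto
  qed
  define r where "r = norm x"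
  define d where "d = sqrt t - r"
  have r: "0 \<le> r" by (simp add: r_def)
  have t: "0 \<le> t" using assms(1) by (smt (verit) zero_le_power2)
  have d: "0 \<le> d"
    using assms(1) by (simp add: d_def r_def real_le_rsqrt)
  have "t = (r + d)\<^sup>2" using t by (simp add: d_def)
  then have s: "d * d + 2 * (r * d) \<le> 1"
    using assms(2) by (simp add: r_def power2_eq_square algebra_simps)
  have rd: "0 \<le> r * d" using r d by simp
  have "d\<^sup>2 \<le> 1\<^sup>2" using s rd by (simp add: power2_eq_square)
  then have "d \<le> 1" by (rule power2_le_imp_le) simp
  moreover have "r * d \<le> 1"
    using s rd mult_nonneg_nonneg[OF d d] by linarith
  ultimately have weight: "d \<le> whitney_weight x"
    by (auto simp: whitney_weight_def r_def field_simps)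
  have "dist x (sqrt t *\<^sub>R u) = norm ((r - sqrt t) *\<^sub>R u)"
    using u(2) by (metis dist_norm r_def scaleR_diff_left)
  also have "\<dots> = d" using u(1) d by (simp add: d_def)
  finally have "dist x (sqrt t *\<^sub>R u) \<le> whitney_weight x" using weight by simp
  moreover have "(norm (sqrt t *\<^sub>R u))\<^sup>2 = t" using u(1) t by simp
  ultimately show ?thesis by blast
qed

definition sphere_gaps :: "real \<Rightarrow> (real ^ 'n) set"
  where "sphere_gaps c = {x. (norm x)\<^sup>2 + c \<notin> \<int>}"

lemma open_sphere_gaps: "open (sphere_gaps c :: (real ^ 'n) set)"
proof -
  have "sphere_gaps c = (\<lambda>x :: real ^ 'n. (norm x)\<^sup>2 + c) -` (- \<int>)"
    by (auto simp: sphere_gaps_def)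
  moreover have "continuous_on UNIV (\<lambda>x :: real ^ 'n. (norm x)\<^sup>2 + c)"
    by (intro continuous_intros)
  moreover have "open (- \<int> :: real set)"
    by (simp add: open_Compl)
  ultimately show ?thesis
    using open_vimage by simp
qed

lemma admissible_sphere_gaps:
  assumes "1 \<le> l"
  shows "admissible_whitney l (sphere_gaps c :: (real ^ 'n) set)"
proof (rule admissible_whitneyI)
  fix x :: "real ^ 'n"
  \<comment> \<open>The squared radius of the first sphere through or outside \<open>x\<close>.\<close>
  define t where "t = real_of_int \<lceil>(norm x)\<^sup>2 + c\<rceil> - c"
  have "(norm x)\<^sup>2 \<le> t" "t \<le> (norm x)\<^sup>2 + 1"
    unfolding t_def by linarith+
  then obtain y :: "real ^ 'n" where y: "(norm y)\<^sup>2 = t" "dist x y \<le> whitney_weight x"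
    using exists_norm_square_near by blast
  have "y \<notin> sphere_gaps c"
    using y(1) by (simp add: sphere_gaps_def t_def)
  moreover have "0 \<le> whitney_weight x"
    using y(2) zero_le_dist[of x y] by linarith
  then have "whitney_weight x \<le> l * whitney_weight x"
    using mult_right_mono[OF assms] by simp
  ultimately show "\<exists>y. y \<notin> sphere_gaps c \<and> dist x y \<le> l * whitney_weight x"
    using y(2) by force
qed

lemma sphere_gaps_cover: "sphere_gaps 0 \<union> sphere_gaps (1/2) = UNIV"
proof -
  have "x \<notin> \<int> \<or> x + 1/2 \<notin> \<int>" for x :: real
  proof (rule ccontr)
    assume "\<not> ?thesis"
    then have "(x + 1/2) - x \<in> \<int>" by (blast intro: Ints_diff)
    then obtain k :: int where "1/2 = real_of_int k" by (auto elim: Ints_cases)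
    then have "1 = real_of_int (2 * k)" by simp
    then have "1 = 2 * k" by linarith
    then show False by presburger
  qed
  then show ?thesis by (auto simp: sphere_gaps_def)
qed

theorem corollary2p9:
  fixes p :: nat
  assumes "p \<ge> 2"
  shows "\<exists>N::nat. \<forall>U :: (real ^ 'n) set. open U \<longrightarrow>
    (\<exists>A :: nat \<Rightarrow> (real ^ 'n) set.
      (\<forall>i<N. open (A i) \<and>
             admissible_whitney (2 ^ (2 * p + 2) * sqrt (real CARD('n))) (A i)) \<and>
      U = (\<Union>i<N. A i))"
proof (intro exI[of _ 2] allI impI)
  fix U :: "(real ^ 'n) set"
  assume U: "open U"
  let ?l = "2 ^ (2 * p + 2) * sqrt (real CARD('n))"
  define A :: "nat \<Rightarrow> (real ^ 'n) set" where "A i = U \<inter> sphere_gaps (real i / 2)" for i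
  have "1 * 1 \<le> ?l"
    by (rule mult_mono) (auto simp: Suc_le_eq simp del: power_Suc)
  then have l: "1 \<le> ?l" by simp
  have "open (A i)" for i
    unfolding A_def by (rule open_Int[OF U open_sphere_gaps])
  moreover have "admissible_whitney ?l (A i)" for i
    using admissible_sphere_gaps[OF l]
    by (rule admissible_whitney_subset[of _ "sphere_gaps (real i / 2)"]) (simp add: A_def)
  moreover have "U = (\<Union>i<2. A i)"
  proof -
    have "(\<Union>i<2. A i) = U \<inter> (sphere_gaps 0 \<union> sphere_gaps (1/2))"
      by (auto simp: A_def less_2_cases_iff)
    then show ?thesis by (simp add: sphere_gaps_cover)
  qed
  ultimately show "\<exists>A :: nat \<Rightarrow> (real ^ 'n) set.
      (\<forall>i<2. open (A i) \<and> admissible_whitney ?l (A i)) \<and> U = (\<Union>i<2. A i)"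
    by (intro exI[of _ A]) simp
qed

end
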